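(* Let $T$ be the $\aleph_0$-regular tree with root $e$ and let $d\colon\mathrm{Aut}(T)\to\mathcal B(\ell_2(T))$ be the derivation $d(g)=L^*\lambda(g)-\lambda(g)L^*$ (restricted to $\ell_2(T)$). Suppose $A\colon \ell_2(T)\to\mathbb C^T$ is a globally defined linear operator (not assumed continuous) so that $d(g)=A\lambda(g)-\lambda(g)A$ on $\ell_2(T)$ for all $g\in\mathrm{Aut}(T)$. Then $A=L^*+\vartheta\,\mathrm{Id}$ on $\ell_2(T)$ for some $\vartheta\in\mathbb C$.
   Context: The $\aleph_0$-regular tree $T$ is the countable tree (connected, acyclic simple graph) in which every vertex has infinitely many neighbours; $T$ also denotes its vertex set, and $\mathrm{Aut}(T)$ is its group of graph automorphisms (not required to fix the root). $\mathbb C^T$ is the vector space of all functions $T\to\mathbb C$, and $\lambda$ is the action of $\mathrm{Aut}(T)$ on $\mathbb C^T$ by $\lambda(g)(x)=x(g^{-1}\,\cdot\,)$; each $\ell_p(T)\subseteq\mathbb C^T$ is $\lambda$-invariant. $\mathbf 1_s$ is the Dirac function at $s\in T$. A root $e\in T$ is fixed; $\hat e=e$, and for $s\neq e$, $\hat s$ is the penultimate vertex on the geodesic from $e$ to $s$. $L\colon\ell_1(T)\to\ell_1(T)$ is the bounded linear operator with $L(\mathbf 1_s)=\mathbf 1_{\hat s}$ for $s\ne e$ and $L(\mathbf 1_e)=0$, and $L^*\colon\ell_\infty(T)\to\ell_\infty(T)$ is its adjoint, so $(L^*x)(s)=x(\hat s)$ for $s\neq e$ and $(L^*x)(e)=0$.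 For every $g\in\mathrm{Aut}(T)$, the operator $L^*\lambda(g)-\lambda(g)L^*$ on $\ell_\infty(T)$ restricts to a bounded operator on $\ell_2(T)$ of norm at most $2$ (and agrees with $\lambda(g)L-L\lambda(g)$ on $\ell_1(T)$); $d(g)$ denotes this restriction to $\ell_2(T)$. *)

theory Defs
  imports "HOL-Analysis.Analysis" "HOL-Library.Function_Algebras"
begin

text \<open>
  A graph is given by the adjacency relation on its vertex type; the vertex set is the whole type.
\<close>

definition walk_between :: "('v \<Rightarrow> 'v \<Rightarrow> bool) \<Rightarrow> 'v \<Rightarrow> 'v \<Rightarrow> 'v list \<Rightarrow> bool" where
  "walk_between E u v p \<longleftrightarrow> p \<noteq> [] \<and> hd p = u \<and> last p = v \<and> successively E p"

definition simple_graph :: "('v \<Rightarrow> 'v \<Rightarrow> bool) \<Rightarrow> bool" where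
  "simple_graph E \<longleftrightarrow> symp E \<and> irreflp E"

definition connected_graph :: "('v \<Rightarrow> 'v \<Rightarrow> bool) \<Rightarrow> bool" where
  "connected_graph E \<longleftrightarrow> (\<forall>u v. \<exists>p. walk_between E u v p)"

definition graph_cycle :: "('v \<Rightarrow> 'v \<Rightarrow> bool) \<Rightarrow> 'v list \<Rightarrow> bool" where
  "graph_cycle E p \<longleftrightarrow>
     3 \<le> length p \<and> distinct p \<and> successively E p \<and> E (last p) (hd p)"

definition acyclic_graph :: "('v \<Rightarrow> 'v \<Rightarrow> bool) \<Rightarrow> bool" where
  "acyclic_graph E \<longleftrightarrow> (\<nexists>p. graph_cycle E p)"

definition aleph0_regular_tree :: "('v \<Rightarrow> 'v \<Rightarrow> bool) \<Rightarrow> bool" where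
  "aleph0_regular_tree E \<longleftrightarrow>
     countable (UNIV :: 'v set) \<and> simple_graph E \<and> connected_graph E \<and> acyclic_graph E \<and>
     (\<forall>v. infinite {w. E v w})"

definition Aut :: "('v \<Rightarrow> 'v \<Rightarrow> bool) \<Rightarrow> ('v \<Rightarrow> 'v) set" where
  "Aut E = {g. bij g \<and> (\<forall>u v. E (g u) (g v) \<longleftrightarrow> E u v)}"

definition geodesic :: "('v \<Rightarrow> 'v \<Rightarrow> bool) \<Rightarrow> 'v \<Rightarrow> 'v \<Rightarrow> 'v list \<Rightarrow> bool" where
  "geodesic E u v p \<longleftrightarrow>
     walk_between E u v p \<and> (\<forall>q. walk_between E u v q \<longrightarrow> length p \<le> length q)"

text \<open>
  The vertex \<open>hat E e s\<close> is the penultimate vertex on the geodesic from the root \<open>e\<close> to \<open>s\<close>;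
  in a tree the geodesic between two vertices is unique.
\<close>

definition hat :: "('v \<Rightarrow> 'v \<Rightarrow> bool) \<Rightarrow> 'v \<Rightarrow> 'v \<Rightarrow> 'v" where
  "hat E e s = (if s = e then e else last (butlast (THE p. geodesic E e s p)))"

definition ell1 :: "('v \<Rightarrow> complex) set" where
  "ell1 = {x. (\<lambda>s. norm (x s)) summable_on UNIV}"

definition ell2 :: "('v \<Rightarrow> complex) set" where
  "ell2 = {x. (\<lambda>s. (norm (x s))\<^sup>2) summable_on UNIV}"

definition ell_infty :: "('v \<Rightarrow> complex) set" where
  "ell_infty = {x. bounded (range x)}"

definition dirac :: "'v \<Rightarrow> 'v \<Rightarrow> complex" where
  "dirac s = (\<lambda>t. if t = s then 1 else 0)"

definition lam :: "('v \<Rightarrow> 'v) \<Rightarrow> ('v \<Rightarrow> complex) \<Rightarrow> 'v \<Rightarrow> complex" where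
  "lam g x = (\<lambda>s. x (inv g s))"

definition linear_from :: "('v \<Rightarrow> complex) set \<Rightarrow> (('v \<Rightarrow> complex) \<Rightarrow> 'v \<Rightarrow> complex) \<Rightarrow> bool" where
  "linear_from S A \<longleftrightarrow>
     (\<forall>x\<in>S. \<forall>y\<in>S. A (x + y) = A x + A y) \<and>
     (\<forall>c. \<forall>x\<in>S. A (\<lambda>s. c * x s) = (\<lambda>s. c * A x s))"

text \<open>
  The operator \<open>L\<close> on \<open>ell1\<close> with \<open>L (dirac s) = dirac (hat E e s)\<close> for \<open>s \<noteq> e\<close> and
  \<open>L (dirac e) = 0\<close>, and its adjoint on \<open>ell_infty\<close> with respect to the
  bilinear pairing of \<open>ell1\<close> and \<open>ell_infty\<close>.
\<close>

definition L_op :: "('v \<Rightarrow> 'v \<Rightarrow> bool) \<Rightarrow> 'v \<Rightarrow> ('v \<Rightarrow> complex) \<Rightarrow> 'v \<Rightarrow> complex" where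
  "L_op E e x = (\<lambda>t. \<Sum>\<^sub>\<infinity>s\<in>{s. s \<noteq> e \<and> hat E e s = t}. x s)"

definition L_adj :: "('v \<Rightarrow> 'v \<Rightarrow> bool) \<Rightarrow> 'v \<Rightarrow> ('v \<Rightarrow> complex) \<Rightarrow> 'v \<Rightarrow> complex" where
  "L_adj E e x = (\<lambda>s. if s = e then 0 else x (hat E e s))"

definition tree_derivation ::
    "('v \<Rightarrow> 'v \<Rightarrow> bool) \<Rightarrow> 'v \<Rightarrow> ('v \<Rightarrow> 'v) \<Rightarrow> ('v \<Rightarrow> complex) \<Rightarrow> 'v \<Rightarrow> complex" where
  "tree_derivation E e g x = L_adj E e (lam g x) - lam g (L_adj E e x)"

lemma L_op_dirac:
  "L_op E e (dirac s) = (if s = e then 0 else dirac (hat E e s))"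
proof
  fix t
  have "L_op E e (dirac s) t = (\<Sum>\<^sub>\<infinity>r\<in>{s} \<inter> {s. s \<noteq> e \<and> hat E e s = t}. 1)"
    unfolding L_op_def by (intro infsum_cong_neutral) (auto simp: dirac_def)
  also have "{s} \<inter> {s. s \<noteq> e \<and> hat E e s = t} = (if s \<noteq> e \<and> hat E e s = t then {s} else {})"
    by auto
  finally show "L_op E e (dirac s) t = (if s = e then 0 else dirac (hat E e s)) t"
    by (auto simp: dirac_def)
qed

lemma L_op_pairing:
  assumes x: "x \<in> ell1" and y: "y \<in> ell_infty"
  shows "(\<lambda>t. norm (L_op E e x t * y t)) summable_on UNIV" (is ?summable)
    and "(\<Sum>\<^sub>\<infinity>t. L_op E e x t * y t) = (\<Sum>\<^sub>\<infinity>s. x s * L_adj E e y s)" (is ?eq)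
proof -
  define F where "F t = {s. s \<noteq> e \<and> hat E e s = t}" for t
  define f where "f = (\<lambda>(t, s). x s * y t)"
  obtain C where C: "\<And>t. norm (y t) \<le> C"
    using y by (auto simp: ell_infty_def bounded_iff)
  have bij: "bij_betw snd (Sigma UNIV F) (- {e})"
    by (rule bij_betwI[where g = "\<lambda>s. (hat E e s, s)"]) (auto simp: F_def)
  have f_bij: "f p = x (snd p) * L_adj E e y (snd p)" if "p \<in> Sigma UNIV F" for p
    using that by (auto simp: f_def F_def L_adj_def)
  have norm_le: "norm (x s * L_adj E e y s) \<le> norm (x s) * C" for s
    using C[of "hat E e s"] order_trans[OF norm_ge_zero C]
    by (auto simp: L_adj_def norm_mult intro!: mult_left_mono)
  have "(\<lambda>s. norm (x s * L_adj E e y s)) summable_on UNIV"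
    by (rule Infinite_Sum.abs_summable_on_comparison_test'[where g = "\<lambda>s. norm (x s) * C"])
       (use x norm_le in \<open>auto simp: ell1_def intro: summable_on_cmult_left\<close>)
  then have "(\<lambda>s. norm (x s * L_adj E e y s)) summable_on (- {e})"
    by (rule summable_on_subset_banach) auto
  then have "(\<lambda>p. norm (x (snd p) * L_adj E e y (snd p))) summable_on Sigma UNIV F"
    using summable_on_reindex_bij_betw[OF bij, of "\<lambda>s. norm (x s * L_adj E e y s)"] by simp
  then have f_abs: "(\<lambda>p. norm (f p)) summable_on Sigma UNIV F"
    by (rule summable_on_cong[THEN iffD1, rotated]) (simp add: f_bij)
  have Lf: "L_op E e x t * y t = (\<Sum>\<^sub>\<infinity>s\<in>F t. f (t, s))" for t
    unfolding L_op_def f_def F_def by (simp add: infsum_cmult_left')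
  have inner: "(\<lambda>t. \<Sum>\<^sub>\<infinity>s\<in>F t. norm (f (t, s))) summable_on UNIV"
    using f_abs unfolding Infinite_Sum.abs_summable_on_Sigma_iff
    by (simp add: infsum_nonneg)
  have "(\<lambda>s. norm (f (t, s))) summable_on F t" for t
    using f_abs unfolding Infinite_Sum.abs_summable_on_Sigma_iff by simp
  then have "norm (L_op E e x t * y t) \<le> (\<Sum>\<^sub>\<infinity>s\<in>F t. norm (f (t, s)))" for t
    unfolding Lf by (intro norm_infsum_bound) auto
  with inner show ?summable
    by (intro Infinite_Sum.abs_summable_on_comparison_test'[OF inner])
  have "(\<Sum>\<^sub>\<infinity>t. L_op E e x t * y t) = infsum f (Sigma UNIV F)"
    unfolding Lf by (rule infsum_Sigma_banach[OF Infinite_Sum.abs_summable_summable[OF f_abs]])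
  also have "\<dots> = (\<Sum>\<^sub>\<infinity>p\<in>Sigma UNIV F. x (snd p) * L_adj E e y (snd p))"
    by (intro infsum_cong f_bij)
  also have "\<dots> = (\<Sum>\<^sub>\<infinity>s\<in>- {e}. x s * L_adj E e y s)"
    by (rule infsum_reindex_bij_betw[OF bij])
  also have "\<dots> = (\<Sum>\<^sub>\<infinity>s. x s * L_adj E e y s)"
    by (rule infsum_cong_neutral) (auto simp: L_adj_def)
  finally show ?eq .
qed

end

theory Submission
  imports Defs
begin

text \<open>
  Put \<open>B = A - L\<^sup>*\<close>. Subtracting the two expressions for the derivation shows that \<open>B\<close> is a linear map
  from \<open>ell2\<close> to all functions that commutes with every automorphism of the tree, so the claim is
  that such a map is a scalar (\<open>equivariant_operator_is_scalar\<close>). No continuity is available, so it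
  has to be extracted from the symmetry by pure algebra.

  For a vertex \<open>v\<close>, the number \<open>(B x) v\<close> is a linear functional of \<open>x\<close> that is invariant under the
  stabilizer of \<open>v\<close>. The stabilizer contains all permutations of the infinitely many isomorphic
  branches at \<open>v\<close>. Suppose that \<open>x\<close> is supported on a suitable infinite set of branches. Moving
  branches around gives permutations \<open>f\<close> and \<open>g\<close> such that the operator averaging the two
  translations acts on the translates of \<open>x\<close> as a contraction: two orthogonal copies of a vector of
  norm 1, each with weight 1/2, add up to a vector of norm \<open>1/sqrt 2\<close>. The Neumann series of this
  operator at \<open>x\<close> therefore converges in \<open>ell2\<close> to some \<open>y\<close> with \<open>y = x + (f y + g y) / 2\<close>, and an
  invariant functional \<open>\<phi>\<close> satisfies \<open>\<phi> y = \<phi> x + \<phi> y\<close>, whence \<open>\<phi> x = 0\<close>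
  (\<open>permutation_invariant_functional_zero\<close>). Consequently \<open>(B x) v\<close> depends on \<open>x v\<close> only, so it is
  \<open>\<theta> v * x v\<close>, and \<open>\<theta>\<close> is constant because the automorphism group is transitive.

  Both the branch permutations and transitivity come from addresses: choosing an enumeration of the
  children of every vertex identifies the tree, rooted at any vertex, with the finite lists of natural
  numbers (\<open>bij_vertex_at\<close>, \<open>vertex_at_adj_iff\<close>). Injectivity of this identification is the uniqueness
  of walks without backtracking in an acyclic graph (\<open>reduced_walk_unique\<close>).
\<close>

section \<open>Walks without backtracking\<close>

fun reduced_walk :: "('v \<Rightarrow> 'v \<Rightarrow> bool) \<Rightarrow> 'v list \<Rightarrow> bool" where
  "reduced_walk E (a # b # c # p) \<longleftrightarrow> E a b \<and> a \<noteq> c \<and> reduced_walk E (b # c # p)"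
| "reduced_walk E [a, b] \<longleftrightarrow> E a b"
| "reduced_walk E [a] \<longleftrightarrow> True"
| "reduced_walk E [] \<longleftrightarrow> True"

lemma reduced_walk_tl: "reduced_walk E (a # p) \<Longrightarrow> reduced_walk E p"
  by (cases "(E, a # p)" rule: reduced_walk.cases) auto

lemma reduced_walk_appendD: "reduced_walk E (p @ q) \<Longrightarrow> reduced_walk E p"
proof (induction p rule: induct_list012)
  case (3 x y zs)
  then show ?case by (cases zs; cases q) auto
qed auto

lemma reduced_walk_successively: "reduced_walk E p \<Longrightarrow> successively E p"
  by (induction E p rule: reduced_walk.induct) auto

text \<open>
  A walk may turn at \<open>u\<close> as long as it arrives from and leaves for different neighbours. This is what
  joins two walks that share only an endpoint.
\<close>

lemma reduced_walk_glue:
  assumes "reduced_walk E (p @ [a, u])" "reduced_walk E (u # b # q)" "a \<noteq> b"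
  shows "reduced_walk E (p @ a # u # b # q)"
  using assms(1)
proof (induction p rule: induct_list012)
  case (2 x)
  then show ?case using assms(2,3) by auto
next
  case (3 x y zs)
  then show ?case by (cases zs) auto
qed (use assms(2,3) in auto)

lemma reduced_walk_rev:
  assumes "symp E" "reduced_walk E p"
  shows "reduced_walk E (rev p)"
  using assms(2)
proof (induction p rule: induct_list012)
  case (3 a b p)
  then show ?case
    using reduced_walk_glue[of E _ _ b a "[]"] sympD[OF assms(1), of a b]
    by (cases p) auto
qed auto

text \<open>
  In a shortest counterexample only the two endpoints coincide, because dropping either of them leaves
  a shorter reduced walk; the walk without its last vertex is then a cycle, its length being at least
  3 by the absence of loops and of backtracking.
\<close>

lemma reduced_walk_distinct:
  assumes "simple_graph E" "acyclic_graph E"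
  shows "reduced_walk E p \<Longrightarrow> distinct p"
proof (induction p rule: length_induct)
  case (1 p)
  show ?case
  proof (rule ccontr)
    assume nd: "\<not> distinct p"
    then obtain a r where p: "p = a # r" by (cases p) auto
    have IH: "reduced_walk E q \<Longrightarrow> length q < length p \<Longrightarrow> distinct q" for q
      using 1 by blast
    have dr: "distinct r" using IH[of r] 1(2) reduced_walk_tl[of E a r] by (simp add: p)
    with nd p have "r \<noteq> []" by auto
    then obtain m b where r: "r = m @ [b]" by (metis rev_exhaust)
    have dm: "distinct (a # m)"
      using IH[of "a # m"] 1(2) reduced_walk_appendD[of E "a # m" "[b]"] by (simp add: p r)
    have b: "b = a" using nd dr dm by (auto simp: p r)
    have suc: "successively E (a # m @ [a])"
      using 1(2) reduced_walk_successively by (auto simp: p r b)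
    have irr: "\<not> E c c" for c using assms(1) by (auto simp: simple_graph_def irreflp_def)
    have "m \<noteq> []" using suc irr by auto
    moreover have "m \<noteq> [c]" for c using 1(2) by (auto simp: p r b)
    ultimately have "3 \<le> length (a # m)"
      by (cases m rule: remdups_adj.cases) auto
    moreover have "successively E (a # m)" "E (last (a # m)) a"
      using suc \<open>m \<noteq> []\<close> by (auto simp: successively_append_iff successively_Cons)
    ultimately have "graph_cycle E (a # m)"
      using dm by (simp add: graph_cycle_def)
    then show False using assms(2) by (auto simp: acyclic_graph_def)
  qed
qed

text \<open>
  If two such walks diverge after the vertex \<open>u\<close>, running backwards along one and forwards along the
  other never backtracks at \<open>u\<close>, yet visits the common endpoint twice.
\<close>

lemma reduced_walk_unique:
  assumes "simple_graph E" "acyclic_graph E"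
  shows "reduced_walk E p \<Longrightarrow> reduced_walk E q \<Longrightarrow> p \<noteq> [] \<Longrightarrow> q \<noteq> [] \<Longrightarrow>
    hd p = hd q \<Longrightarrow> last p = last q \<Longrightarrow> p = q"
proof (induction p arbitrary: q)
  case (Cons u p)
  obtain q' where q: "q = u # q'" using Cons.prems by (cases q) auto
  have d: "distinct (u # p)" "distinct (u # q')"
    using Cons.prems(1,2) reduced_walk_distinct[OF assms] unfolding q by blast+
  show ?case
  proof (cases "p = [] \<or> q' = []")
    case True
    then show ?thesis using Cons.prems d by (auto simp: q split: if_splits)
  next
    case False
    then obtain a p' b q'' where pq: "p = a # p'" "q' = b # q''"
      by (metis neq_Nil_conv)
    have "a = b"
    proof (rule ccontr)
      assume "a \<noteq> b"
      have "symp E" using assms(1) by (simp add: simple_graph_def)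
      with Cons.prems have "reduced_walk E (rev p' @ [a, u])"
        using reduced_walk_rev[of E "u # a # p'"] by (simp add: pq)
      with Cons.prems \<open>a \<noteq> b\<close> have "reduced_walk E (rev p' @ a # u # b # q'')"
        by (intro reduced_walk_glue) (auto simp: q pq)
      then have "distinct (rev p' @ a # u # b # q'')"
        by (rule reduced_walk_distinct[OF assms])
      moreover have "last (a # p') = last (b # q'')" using Cons.prems by (simp add: q pq)
      then have "last (a # p') \<in> set (a # p') \<inter> set (b # q'')"
        by (metis IntI last_in_set list.discI)
      ultimately show False by auto
    qed
    then show ?thesis
      using Cons.IH[of q'] Cons.prems reduced_walk_tl[of E u] by (auto simp: q pq)
  qed
qed simp

section \<open>Addresses of vertices in the regular tree\<close>

text \<open>
  Addresses are read from the head of the list upwards: \<open>k # l\<close> is the \<open>k\<close>-th child of \<open>l\<close>, so the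
  last entry names the branch at the root. The recursion carries the parent of the current vertex
  along, as a set that is empty at the root and a singleton elsewhere.
\<close>

primrec labelling :: "('v \<Rightarrow> 'v \<Rightarrow> bool) \<Rightarrow> 'v \<Rightarrow> nat list \<Rightarrow> 'v \<times> 'v set" where
  "labelling E v [] = (v, {})"
| "labelling E v (k # l) = (let (u, P) = labelling E v l in (from_nat_into ({w. E u w} - P) k, {u}))"

definition vertex_at :: "('v \<Rightarrow> 'v \<Rightarrow> bool) \<Rightarrow> 'v \<Rightarrow> nat list \<Rightarrow> 'v" where
  "vertex_at E v l = fst (labelling E v l)"

definition parents_at :: "('v \<Rightarrow> 'v \<Rightarrow> bool) \<Rightarrow> 'v \<Rightarrow> nat list \<Rightarrow> 'v set" where
  "parents_at E v l = snd (labelling E v l)"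

lemma vertex_at_simps [simp]:
  "vertex_at E v [] = v"
  "vertex_at E v (k # l) = from_nat_into ({w. E (vertex_at E v l) w} - parents_at E v l) k"
  by (auto simp: vertex_at_def parents_at_def split: prod.splits)

lemma parents_at_simps [simp]:
  "parents_at E v [] = {}"
  "parents_at E v (k # l) = {vertex_at E v l}"
  by (auto simp: vertex_at_def parents_at_def split: prod.splits)

lemma bij_betw_vertex_at_Cons:
  assumes "aleph0_regular_tree E"
  shows "bij_betw (\<lambda>k. vertex_at E v (k # l)) UNIV ({w. E (vertex_at E v l) w} - parents_at E v l)"
proof -
  have "finite (parents_at E v l)" by (cases l) auto
  moreover have "infinite {w. E (vertex_at E v l) w}" "countable (UNIV :: 'a set)"
    using assms by (auto simp: aleph0_regular_tree_def)
  ultimately show ?thesis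
    by (simp add: bij_betw_from_nat_into countable_subset[OF subset_UNIV])
qed

lemma vertex_at_Cons_adj:
  assumes "aleph0_regular_tree E"
  shows "E (vertex_at E v l) (vertex_at E v (k # l))" "vertex_at E v (k # l) \<notin> parents_at E v l"
  using bij_betw_apply[OF bij_betw_vertex_at_Cons[OF assms, of v l], of k] by auto

text \<open>
  The vertices from an address up to the root; two addresses of the same vertex are compared through
  these walks.
\<close>

primrec ascent :: "('v \<Rightarrow> 'v \<Rightarrow> bool) \<Rightarrow> 'v \<Rightarrow> nat list \<Rightarrow> 'v list" where
  "ascent E v [] = [v]"
| "ascent E v (k # l) = vertex_at E v (k # l) # ascent E v l"

lemma hd_ascent: "hd (ascent E v l) = vertex_at E v l" "ascent E v l \<noteq> []"
  by (cases l; simp)+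

lemma last_ascent: "last (ascent E v l) = v"
  by (induction l) (auto simp: hd_ascent)

lemma reduced_walk_ascent:
  assumes "aleph0_regular_tree E"
  shows "reduced_walk E (ascent E v l)"
proof (induction l rule: induct_list012)
  case (2 k)
  then show ?case
    using vertex_at_Cons_adj(1)[OF assms, where l = "[]" and k = k and v = v] assms
    by (auto simp: aleph0_regular_tree_def simple_graph_def dest: sympD simp del: vertex_at_simps(2))
next
  case (3 k j l)
  have "E (vertex_at E v (k # j # l)) (vertex_at E v (j # l))"
    using vertex_at_Cons_adj(1)[OF assms, where l = "j # l" and k = k and v = v] assms
    by (auto simp: aleph0_regular_tree_def simple_graph_def dest: sympD simp del: vertex_at_simps(2))
  moreover have "vertex_at E v (k # j # l) \<noteq> vertex_at E v l"
    using vertex_at_Cons_adj(2)[OF assms, where l = "j # l" and k = k and v = v] by auto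
  ultimately show ?case using 3
    by (cases l) (auto simp del: vertex_at_simps(2))
qed simp

text \<open>
  Addresses of the same vertex give reduced walks with the same endpoints, hence the same walk, from
  which the address can be read off because siblings have different names.
\<close>

lemma inj_vertex_at:
  assumes "aleph0_regular_tree E"
  shows "inj (vertex_at E v)"
proof (rule injI)
  fix l m assume "vertex_at E v l = vertex_at E v m"
  then have "ascent E v l = ascent E v m"
    using assms by (intro reduced_walk_unique[of E] reduced_walk_ascent)
      (auto simp: hd_ascent last_ascent aleph0_regular_tree_def)
  then show "l = m"
  proof (induction l arbitrary: m)
    case Nil
    then show ?case by (cases m) (auto simp: hd_ascent(2)[symmetric])
  next
    case (Cons k l)
    then obtain j m' where m: "m = j # m'"
      by (cases m) (auto simp: hd_ascent)
    with Cons have "l = m'" by auto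
    moreover from Cons.prems m have "vertex_at E v (k # l) = vertex_at E v (j # m')" by simp
    ultimately have "k = j"
      using bij_betw_imp_inj_on[OF bij_betw_vertex_at_Cons[OF assms, of v l]]
      by (auto simp: inj_on_def simp del: vertex_at_simps(2))
    with \<open>l = m'\<close> m show ?case by simp
  qed
qed

lemma vertex_at_neighbour:
  assumes "aleph0_regular_tree E" "E (vertex_at E v l) w"
  obtains k where "w = vertex_at E v (k # l)" | k m where "l = k # m" "w = vertex_at E v m"
proof (cases "w \<in> parents_at E v l")
  case True
  then show ?thesis using that by (cases l) auto
next
  case False
  then have "w \<in> range (\<lambda>k. vertex_at E v (k # l))"
    using bij_betw_imp_surj_on[OF bij_betw_vertex_at_Cons[OF assms(1), of v l]] assms(2) by blast
  then show ?thesis using that by blast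
qed

text \<open>
  Every neighbour of an addressed vertex has an address, so surjectivity follows by walking from the
  root.
\<close>

lemma bij_vertex_at:
  assumes "aleph0_regular_tree E"
  shows "bij (vertex_at E v)"
proof -
  have "w \<in> range (vertex_at E v)" for w
  proof -
    have "successively E p \<Longrightarrow> p \<noteq> [] \<Longrightarrow> hd p \<in> range (vertex_at E v) \<Longrightarrow>
        last p \<in> range (vertex_at E v)" for p
    proof (induction p rule: induct_list012)
      case (3 x y zs)
      then obtain l where l: "x = vertex_at E v l" by auto
      have "E (vertex_at E v l) y" using 3 l by simp
      then have "y \<in> range (vertex_at E v)"
        by (rule vertex_at_neighbour[OF assms]) blast+
      then show ?case using 3 by simp
    qed auto
    moreover obtain p where "walk_between E v w p"
      using assms unfolding aleph0_regular_tree_def connected_graph_def by blast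
    moreover have "v \<in> range (vertex_at E v)" by (metis rangeI vertex_at_simps(1))
    ultimately show ?thesis unfolding walk_between_def by metis
  qed
  then show ?thesis using inj_vertex_at[OF assms] by (auto simp: bij_def)
qed

lemma vertex_at_adj_iff:
  assumes "aleph0_regular_tree E"
  shows "E (vertex_at E v l) (vertex_at E v m) \<longleftrightarrow> (\<exists>k. l = k # m \<or> m = k # l)"
proof
  assume "E (vertex_at E v l) (vertex_at E v m)"
  then show "\<exists>k. l = k # m \<or> m = k # l"
    by (rule vertex_at_neighbour[OF assms]) (auto dest!: injD[OF inj_vertex_at[OF assms]] simp del: vertex_at_simps(2))
next
  assume "\<exists>k. l = k # m \<or> m = k # l"
  then show "E (vertex_at E v l) (vertex_at E v m)"
    using vertex_at_Cons_adj(1)[OF assms] assms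
    by (auto simp: aleph0_regular_tree_def simple_graph_def dest: sympD simp del: vertex_at_simps(2))
qed

section \<open>Automorphisms\<close>

lemma Aut_inv:
  assumes "g \<in> Aut E"
  shows "inv g \<in> Aut E"
proof -
  have "bij g" using assms by (simp add: Aut_def)
  moreover have "E (inv g u) (inv g w) \<longleftrightarrow> E u w" for u w
  proof -
    have "E (g (inv g u)) (g (inv g w)) \<longleftrightarrow> E (inv g u) (inv g w)"
      using assms by (simp add: Aut_def)
    then show ?thesis using \<open>bij g\<close> by (simp add: bij_is_surj surj_f_inv_f)
  qed
  ultimately show ?thesis by (simp add: Aut_def bij_imp_bij_inv)
qed

text \<open>
  Addressing from \<open>v\<close> and from \<open>w\<close> may be combined: with \<open>h = id\<close> this moves \<open>v\<close> to \<open>w\<close>, and with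
  \<open>v = w\<close> and \<open>h\<close> permuting branches it lies in the stabilizer of \<open>v\<close>.
\<close>

lemma Aut_by_addresses:
  assumes "aleph0_regular_tree E" "bij h"
    and "\<And>l m. (\<exists>k. h l = k # h m \<or> h m = k # h l) \<longleftrightarrow> (\<exists>k. l = k # m \<or> m = k # l)"
  shows "vertex_at E w \<circ> h \<circ> inv (vertex_at E v) \<in> Aut E"
proof -
  have "E (vertex_at E w (h (inv (vertex_at E v) s))) (vertex_at E w (h (inv (vertex_at E v) t))) \<longleftrightarrow> E s t" for s t
  proof -
    obtain l m where lm: "s = vertex_at E v l" "t = vertex_at E v m"
      using bij_vertex_at[OF assms(1), of v] by (meson bij_pointE)
    then show ?thesis
      by (simp add: inv_f_f inj_vertex_at vertex_at_adj_iff assms del: vertex_at_simps(2))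
  qed
  moreover have "bij (vertex_at E w \<circ> h \<circ> inv (vertex_at E v))"
    by (intro bij_comp bij_imp_bij_inv bij_vertex_at assms)
  ultimately show ?thesis by (simp add: Aut_def)
qed

lemma Aut_transitive:
  assumes "aleph0_regular_tree E"
  obtains g where "g \<in> Aut E" "g v = w"
proof
  show "vertex_at E w \<circ> id \<circ> inv (vertex_at E v) \<in> Aut E"
    by (rule Aut_by_addresses[OF assms]) auto
  have "inv (vertex_at E v) v = []"
    by (rule inv_f_eq[OF inj_vertex_at[OF assms]]) simp
  then show "(vertex_at E w \<circ> id \<circ> inv (vertex_at E v)) v = w" by simp
qed

definition permute_branches :: "(nat \<Rightarrow> nat) \<Rightarrow> nat list \<Rightarrow> nat list" where
  "permute_branches \<rho> l = (if l = [] then [] else butlast l @ [\<rho> (last l)])"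

lemma permute_branches_simps [simp]:
  "permute_branches \<rho> [] = []"
  "permute_branches \<rho> (r @ [n]) = r @ [\<rho> n]"
  by (simp_all add: permute_branches_def)

lemma permute_branches_comp:
  "permute_branches \<rho> (permute_branches \<sigma> l) = permute_branches (\<rho> \<circ> \<sigma>) l"
  by (simp add: permute_branches_def)

lemma permute_branches_id: "permute_branches id l = l"
  by (simp add: permute_branches_def)

lemma permute_branches_step:
  "\<exists>k. l = k # m \<or> m = k # l \<Longrightarrow>
    \<exists>k. permute_branches \<rho> l = k # permute_branches \<rho> m \<or> permute_branches \<rho> m = k # permute_branches \<rho> l"
  by (auto simp: permute_branches_def)

lemma permute_branches_Aut:
  assumes "aleph0_regular_tree E" "bij \<rho>"
  shows "vertex_at E v \<circ> permute_branches \<rho> \<circ> inv (vertex_at E v) \<in> Aut E"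
proof (rule Aut_by_addresses[OF assms(1)])
  have inv: "permute_branches (inv \<rho>) (permute_branches \<rho> l) = l"
    "permute_branches \<rho> (permute_branches (inv \<rho>) l) = l" for l
    using assms(2)
    by (simp_all add: permute_branches_comp permute_branches_id bij_is_inj bij_is_surj
        surj_iff[THEN iffD1])
  then show "bij (permute_branches \<rho>)" by (metis bijI')
  show "(\<exists>k. permute_branches \<rho> l = k # permute_branches \<rho> m \<or>
      permute_branches \<rho> m = k # permute_branches \<rho> l) \<longleftrightarrow> (\<exists>k. l = k # m \<or> m = k # l)" for l m
    using permute_branches_step[of l m \<rho>]
      permute_branches_step[of "permute_branches \<rho> l" "permute_branches \<rho> m" "inv \<rho>"]
    unfolding inv by blast
qed

section \<open>Square-summable functions\<close>

lemma ell2_dominated: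
  assumes "x \<in> ell2" "\<And>t. norm (y t) \<le> norm (x t)"
  shows "y \<in> ell2"
proof -
  have "(\<lambda>t. (norm (x t))\<^sup>2) summable_on UNIV" using assms(1) by (simp add: ell2_def)
  then have "(\<lambda>t. (norm (y t))\<^sup>2) summable_on UNIV"
    by (rule summable_on_comparison_test) (auto intro: power_mono assms(2))
  then show ?thesis by (simp add: ell2_def)
qed

lemma ell2_scale: "x \<in> ell2 \<Longrightarrow> (\<lambda>t. c * x t) \<in> ell2"
  by (auto simp: ell2_def norm_mult power_mult_distrib intro: summable_on_cmult_right)

lemma ell2_add:
  assumes "x \<in> ell2" "y \<in> ell2"
  shows "(\<lambda>t. x t + y t) \<in> ell2"
proof -
  have "(\<lambda>t. 2 * (norm (x t))\<^sup>2 + 2 * (norm (y t))\<^sup>2) summable_on UNIV"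
    using assms by (auto simp: ell2_def intro!: summable_on_add summable_on_cmult_right)
  moreover have "(norm (x t + y t))\<^sup>2 \<le> 2 * (norm (x t))\<^sup>2 + 2 * (norm (y t))\<^sup>2" for t
  proof -
    have "(norm (x t + y t))\<^sup>2 \<le> (norm (x t) + norm (y t))\<^sup>2"
      by (intro power_mono norm_triangle_ineq) simp
    also have "\<dots> \<le> 2 * (norm (x t))\<^sup>2 + 2 * (norm (y t))\<^sup>2"
      using sum_squares_bound[of "norm (x t)" "norm (y t)"] by (simp add: power2_sum)
    finally show ?thesis .
  qed
  ultimately have "(\<lambda>t. (norm (x t + y t))\<^sup>2) summable_on UNIV"
    by (rule summable_on_comparison_test) auto
  then show ?thesis by (simp add: ell2_def)
qed

lemma ell2_reindex:
  assumes "x \<in> ell2" "inj g"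
  shows "x \<circ> g \<in> ell2"
proof -
  have "(\<lambda>t. (norm (x t))\<^sup>2) summable_on range g"
    using assms(1) by (auto simp: ell2_def intro: summable_on_subset_banach)
  then show ?thesis
    using summable_on_reindex[OF assms(2), of "\<lambda>t. (norm (x t))\<^sup>2"] by (simp add: ell2_def o_def)
qed

text \<open>
  Converse of \<open>ell2_reindex\<close> for functions living on the range of \<open>g\<close>.
\<close>

lemma ell2_extend_by_zero:
  assumes "x \<circ> g \<in> ell2" "inj g" "\<And>t. t \<notin> range g \<Longrightarrow> x t = 0"
  shows "x \<in> ell2"
proof -
  have "(\<lambda>t. (norm (x t))\<^sup>2) summable_on range g"
    using assms(1) summable_on_reindex[OF assms(2), of "\<lambda>t. (norm (x t))\<^sup>2"]
    by (simp add: ell2_def o_def)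
  then have "(\<lambda>t. (norm (x t))\<^sup>2) summable_on UNIV"
    by (rule summable_on_cong_neutral[THEN iffD1, rotated -1]) (auto simp: assms(3))
  then show ?thesis by (simp add: ell2_def)
qed

lemma dirac_ell2: "dirac v \<in> ell2"
proof -
  have "(\<lambda>t. (norm (dirac v t))\<^sup>2) summable_on {v}" by simp
  then have "(\<lambda>t. (norm (dirac v t))\<^sup>2) summable_on UNIV"
    by (rule summable_on_cong_neutral[THEN iffD1, rotated -1]) (auto simp: dirac_def)
  then show ?thesis by (simp add: ell2_def)
qed

lemma ell2_permute_first:
  assumes "x \<in> ell2" "bij \<pi>"
  shows "x \<circ> map_prod \<pi> id \<in> ell2"
  by (rule ell2_reindex[OF assms(1) prod.inj_map[OF bij_is_inj[OF assms(2)] inj_on_id]])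

section \<open>Functionals invariant under permutations\<close>

text \<open>
  The complements of the domain and of the range are both countably infinite, so any bijection between
  them completes \<open>c\<close>.
\<close>

lemma extend_to_permutation:
  fixes c :: "'i \<Rightarrow> 'i"
  assumes "countable (UNIV :: 'i set)" "inj_on c J" "infinite (- J)" "infinite (- c ` J)"
  obtains \<pi> where "bij \<pi>" "\<And>j. j \<in> J \<Longrightarrow> \<pi> j = c j"
proof -
  have cnt: "countable (- J)" "countable (- c ` J)"
    by (rule countable_subset[OF subset_UNIV assms(1)])+
  define d where "d = from_nat_into (- c ` J) \<circ> to_nat_on (- J)"
  have "bij_betw d (- J) (- c ` J)"
    unfolding d_def using cnt assms
    by (intro bij_betw_trans[OF to_nat_on_infinite] bij_betw_from_nat_into)
  moreover have "bij_betw c J (c ` J)" using assms(2) by (simp add: bij_betw_def)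
  ultimately have "bij_betw (\<lambda>x. if x \<in> J then c x else d x) (J \<union> - J) (c ` J \<union> - c ` J)"
    by (intro bij_betw_disjoint_Un) auto
  then show ?thesis
    using that[of "\<lambda>x. if x \<in> J then c x else d x"] by simp
qed

text \<open>
  There are \<open>2 ^ n\<close> words of length \<open>n\<close>, so the total is the geometric series of ratio 1/2. The weight
  1/4 is the square of the weight 1/2 given to each of the two translations in the averaging
  operator, and convergence here is what keeps the Neumann series square summable.
\<close>

lemma summable_on_geometric_words: "(\<lambda>w :: bool list. (1/4 :: real) ^ length w) summable_on UNIV"
proof (rule nonneg_bounded_partial_sums_imp_summable_on)
  define W where "W n = {w :: bool list. length w \<le> n}" for n
  have fin: "finite (W n)" for n
    using finite_lists_length_le[of "UNIV :: bool set" n] by (simp add: W_def)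
  have le: "(\<Sum>w\<in>W n. (1/4 :: real) ^ length w) \<le> 2" for n
  proof (induction n)
    case (Suc n)
    have "W (Suc n) = insert [] (Cons False ` W n \<union> Cons True ` W n)"
    proof (rule set_eqI)
      fix w show "w \<in> W (Suc n) \<longleftrightarrow> w \<in> insert [] (Cons False ` W n \<union> Cons True ` W n)"
        by (cases w; cases "hd w") (auto simp: W_def)
    qed
    also have "(\<Sum>w\<in>\<dots>. (1/4 :: real) ^ length w) =
        1 + ((\<Sum>w\<in>Cons False ` W n. (1/4) ^ length w) + (\<Sum>w\<in>Cons True ` W n. (1/4) ^ length w))"
      by (subst sum.insert) (auto simp: fin intro!: sum.union_disjoint)
    also have "\<dots> = 1 + (\<Sum>w\<in>W n. (1/4) ^ length w) / 2"
      by (simp add: sum.reindex sum_divide_distrib[symmetric] flip: sum_distrib_left)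
    finally show ?case using Suc by simp
  qed (auto simp: W_def)
  show "\<forall>\<^sub>F F in finite_subsets_at_top UNIV. (\<Sum>w\<in>F. (1/4 :: real) ^ length (w :: bool list)) \<le> 2"
  proof (rule eventually_finite_subsets_at_top_weakI)
    fix F :: "bool list set" assume F: "finite F"
    then have "F \<subseteq> W (Max (length ` F))" by (auto simp: W_def)
    then have "(\<Sum>w\<in>F. (1/4 :: real) ^ length w) \<le> (\<Sum>w\<in>W (Max (length ` F)). (1/4) ^ length w)"
      by (intro sum_mono2 fin) auto
    with le show "(\<Sum>w\<in>F. (1/4 :: real) ^ length w) \<le> 2" by (meson order_trans)
  qed
qed simp

text \<open>
  Names for the branches, arranged for the averaging argument. The names \<open>([], i, True)\<close> are the sources;
  \<open>(w, i, True)\<close> is the place to which the word \<open>w\<close> in two translations carries the source \<open>i\<close>. The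
  names ending in \<open>False\<close> are spare room: they make complements infinite, so that partial
  injections extend to permutations.
\<close>

type_synonym label = "bool list \<times> nat \<times> bool"

text \<open>
  The second component \<open>r\<close> stands for the position within a branch and is only carried along. The
  function \<open>y\<close> of the proof is the Neumann series of the averaging operator at \<open>x\<close>; it copies \<open>x\<close> to
  every word \<open>w\<close> with weight \<open>(1/2) ^ length w\<close>.
\<close>

lemma permutation_invariant_functional_zero_on_sources:
  fixes \<phi> :: "(label \<times> 'r \<Rightarrow> complex) \<Rightarrow> complex"
  assumes add: "\<And>x y. x \<in> ell2 \<Longrightarrow> y \<in> ell2 \<Longrightarrow> \<phi> (\<lambda>t. x t + y t) = \<phi> x + \<phi> y"
    and scale: "\<And>c x. x \<in> ell2 \<Longrightarrow> \<phi> (\<lambda>t. c * x t) = c * \<phi> x"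
    and inv: "\<And>\<pi> x. bij \<pi> \<Longrightarrow> x \<in> ell2 \<Longrightarrow> \<phi> (x \<circ> map_prod \<pi> id) = \<phi> x"
    and x: "x \<in> ell2" "\<And>w i b r. w \<noteq> [] \<or> \<not> b \<Longrightarrow> x ((w, i, b), r) = 0"
  shows "\<phi> x = 0"
proof -
  define y :: "label \<times> 'r \<Rightarrow> complex" where "y = (\<lambda>((w, i, b), r). if b then (1/2) ^ length w * x (([], i, True), r) else 0)"
  have y: "y \<in> ell2"
  proof (rule ell2_extend_by_zero)
    let ?h = "\<lambda>(w, i, r). ((w, i, True), r) :: label \<times> 'r"
    let ?n = "\<lambda>p. (norm ((x \<circ> (\<lambda>(i, r). (([], i, True), r))) p))\<^sup>2"
    have "x \<circ> (\<lambda>(i, r). (([], i, True), r)) \<in> ell2"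
      by (rule ell2_reindex[OF x(1)]) (auto simp: inj_def)
    then have "?n summable_on UNIV" by (simp add: ell2_def)
    then have "((\<lambda>p. (1/4) ^ length w * ?n p) has_sum ((1/4) ^ length w * infsum ?n UNIV)) UNIV"
      for w :: "bool list"
      by (intro has_sum_cmult_right has_sum_infsum)
    then have "(\<lambda>(w :: bool list, p). (1/4) ^ length w * ?n p) summable_on UNIV \<times> UNIV"
      by (intro summable_on_SigmaI[where g = "\<lambda>w. (1/4) ^ length w * infsum ?n UNIV"]
            summable_on_cmult_left summable_on_geometric_words) auto
    moreover have four: "(4 :: real) ^ n = (2 ^ n)\<^sup>2" for n
      by (simp add: power2_eq_square flip: power_mult_distrib)
    have "(\<lambda>(w :: bool list, p). (1/4) ^ length w * ?n p) = (\<lambda>t. (norm ((y \<circ> ?h) t))\<^sup>2)"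
      using four by (auto simp: y_def fun_eq_iff norm_mult norm_divide norm_power power_divide)
    ultimately show "y \<circ> ?h \<in> ell2" by (simp add: ell2_def)
    show "inj ?h" by (auto simp: inj_def)
    show "y t = 0" if "t \<notin> range ?h" for t
      using that by (force simp: y_def image_iff split: prod.splits)
  qed
  \<comment> \<open>Deleting the first letter of the words that begin with \<open>a\<close> extends to a permutation \<open>\<pi>\<close>. All names
    ending in \<open>True\<close> are values of this partial map, so \<open>\<pi>\<close> sends every other name into the
    spare room, where \<open>y\<close> vanishes.\<close>
  have shift: "\<exists>\<pi>. bij \<pi> \<and> (\<forall>w i r. y (\<pi> (a # w, i, True), r) = y ((w, i, True), r)) \<and>
      (\<forall>l r. (\<forall>w i. l \<noteq> (a # w, i, True)) \<longrightarrow> y (\<pi> l, r) = 0)" for a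
  proof -
    define J where "J = {l :: label. \<exists>w i. l = (a # w, i, True)}"
    define c where "c = (\<lambda>(w, i, b). (tl w, i, b) :: label)"
    have inj: "inj_on c J" by (auto simp: inj_on_def c_def J_def)
    have cJ: "c ` J = {l. snd (snd l)}"
      by (force simp: c_def J_def image_iff)
    have inf: "infinite {l :: label. \<not> snd (snd l)}"
    proof
      assume "finite {l :: label. \<not> snd (snd l)}"
      moreover have "range (\<lambda>i. ([], i, False)) \<subseteq> {l :: label. \<not> snd (snd l)}" by auto
      ultimately have "finite (range (\<lambda>i. ([], i, False) :: label))" by (rule rev_finite_subset)
      then show False by (auto dest!: finite_imageD simp: inj_def)
    qed
    then have "infinite (- J)" by (rule infinite_super[rotated]) (auto simp: J_def)
    moreover have "infinite (- c ` J)" using inf unfolding cJ by (simp add: Collect_neg_eq)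
    ultimately obtain \<pi> where \<pi>: "bij \<pi>" "\<And>l. l \<in> J \<Longrightarrow> \<pi> l = c l"
      using extend_to_permutation[OF _ inj] by auto
    have "y (\<pi> l, r) = 0" if "l \<notin> J" for l r
    proof -
      have "\<pi> l \<notin> \<pi> ` J" using that \<pi>(1) by (simp add: bij_is_inj inj_image_mem_iff)
      also have "\<pi> ` J = c ` J" using \<pi>(2) by simp
      finally show ?thesis unfolding cJ by (auto simp: y_def split: prod.splits)
    qed
    moreover have "\<pi> (a # w, i, True) = (w, i, True)" for w i
      using \<pi>(2)[of "(a # w, i, True)"] by (simp add: J_def c_def)
    ultimately show ?thesis using \<pi>(1) by (intro exI[of _ \<pi>]) (auto simp: J_def)
  qed
  obtain f where f: "bij f" "\<And>w i r. y (f (False # w, i, True), r) = y ((w, i, True), r)"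
    "\<And>l r. (\<And>w i. l \<noteq> (False # w, i, True)) \<Longrightarrow> y (f l, r) = 0"
    using shift[of False] by metis
  obtain g where g: "bij g" "\<And>w i r. y (g (True # w, i, True), r) = y ((w, i, True), r)"
    "\<And>l r. (\<And>w i. l \<noteq> (True # w, i, True)) \<Longrightarrow> y (g l, r) = 0"
    using shift[of True] by metis
  let ?f = "y \<circ> map_prod f id" and ?g = "y \<circ> map_prod g id"
  have fg: "?f \<in> ell2" "?g \<in> ell2"
    by (intro ell2_permute_first y f(1) g(1))+
  \<comment> \<open>A word is empty, where \<open>y\<close> is \<open>x\<close>, or begins with exactly one of the two letters, where \<open>y\<close> is half
    its value at the shortened word.\<close>
  have "y = (\<lambda>t. x t + (1/2) * (?f t + ?g t))"
  proof
    fix t :: "label \<times> 'r"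
    obtain w i b r where t: "t = ((w, i, b), r)" by (cases t) auto
    consider "\<not> b" | "b" "w = []" | u where "b" "w = False # u" | u where "b" "w = True # u"
      by (cases w) auto
    then show "y t = x t + (1/2) * (?f t + ?g t)"
    proof cases
      case 1
      then show ?thesis using f(3)[of "(w, i, b)" r] g(3)[of "(w, i, b)" r] x(2) by (simp add: t y_def)
    next
      case 2
      then show ?thesis using f(3)[of "(w, i, b)" r] g(3)[of "(w, i, b)" r] by (simp add: t y_def)
    next
      case (3 u)
      then show ?thesis using f(2)[of u i r] g(3)[of "(w, i, b)" r] x(2) by (simp add: t y_def)
    next
      case (4 u)
      then show ?thesis using g(2)[of u i r] f(3)[of "(w, i, b)" r] x(2) by (simp add: t y_def)
    qed
  qed
  then have "\<phi> y = \<phi> (\<lambda>t. x t + (1/2) * (?f t + ?g t))" by simp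
  also have "\<dots> = \<phi> x + (1/2) * (\<phi> ?f + \<phi> ?g)"
    by (simp only: add[OF x(1) ell2_scale[OF ell2_add[OF fg]]] scale[OF ell2_add[OF fg]] add[OF fg])
  also have "\<phi> ?f + \<phi> ?g = 2 * \<phi> y" using inv f(1) g(1) y by simp
  finally show ?thesis by simp
qed

text \<open>
  An arbitrary function is the sum of its restrictions to the sources and to the other names; a
  permutation exchanging these two infinite sets of names turns the second part into a function
  supported on the sources.
\<close>

lemma permutation_invariant_functional_zero:
  fixes \<phi> :: "(label \<times> 'r \<Rightarrow> complex) \<Rightarrow> complex"
  assumes add: "\<And>x y. x \<in> ell2 \<Longrightarrow> y \<in> ell2 \<Longrightarrow> \<phi> (\<lambda>t. x t + y t) = \<phi> x + \<phi> y"
    and scale: "\<And>c x. x \<in> ell2 \<Longrightarrow> \<phi> (\<lambda>t. c * x t) = c * \<phi> x"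
    and inv: "\<And>\<pi> x. bij \<pi> \<Longrightarrow> x \<in> ell2 \<Longrightarrow> \<phi> (x \<circ> map_prod \<pi> id) = \<phi> x"
    and x: "x \<in> ell2"
  shows "\<phi> x = 0"
proof -
  define S :: "label set" where "S = range (\<lambda>i. ([], i, True))"
  have S_iff: "(w, i, b) \<in> S \<longleftrightarrow> w = [] \<and> b" for w i b
    unfolding S_def by blast
  have source: "\<phi> z = 0" if "z \<in> ell2" "\<And>l r. l \<notin> S \<Longrightarrow> z (l, r) = 0" for z
  proof -
    have "z ((w, i, b), r) = 0" if "w \<noteq> [] \<or> \<not> b" for w i b r
      using that \<open>\<And>l r. l \<notin> S \<Longrightarrow> z (l, r) = 0\<close> by (simp add: S_iff)
    then show ?thesis
      by (intro permutation_invariant_functional_zero_on_sources[of \<phi> z] add scale inv \<open>z \<in> ell2\<close>)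
  qed
  have inf: "infinite S" unfolding S_def by (auto dest!: finite_imageD simp: inj_def)
  have "inj (\<lambda>i. ([], i, False) :: label)" by (auto simp: inj_def)
  then have infc: "infinite (- S)"
    using infinite_super[of "range (\<lambda>i. ([], i, False) :: label)" "- S"]
    by (auto simp: S_def finite_image_iff)
  define c where "c = from_nat_into (- S) \<circ> to_nat_on S"
  have "bij_betw c S (- S)"
    unfolding c_def using inf infc
    by (intro bij_betw_trans[OF to_nat_on_infinite] bij_betw_from_nat_into) auto
  then have c: "inj_on c S" "c ` S = - S" by (auto simp: bij_betw_def)
  obtain \<pi> where \<pi>: "bij \<pi>" "\<And>l. l \<in> S \<Longrightarrow> \<pi> l = c l"
    using extend_to_permutation[OF _ c(1)] inf infc c(2) by auto
  have \<pi>S: "\<pi> ` S = - S" using \<pi>(2) c(2) by simp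
  define x1 where "x1 = (\<lambda>(l, r). if l \<in> S then x (l, r) else 0)"
  define x2 where "x2 = (\<lambda>(l, r). if l \<in> S then 0 else x (l, r))"
  have "norm (x1 t) \<le> norm (x t)" for t by (cases t) (simp add: x1_def)
  then have x1: "x1 \<in> ell2" by (rule ell2_dominated[OF x])
  have "norm (x2 t) \<le> norm (x t)" for t by (cases t) (simp add: x2_def)
  then have x2: "x2 \<in> ell2" by (rule ell2_dominated[OF x])
  have "\<phi> x1 = 0" by (rule source[OF x1]) (simp add: x1_def)
  moreover have "\<phi> (x2 \<circ> map_prod \<pi> id) = 0"
  proof (rule source)
    show "x2 \<circ> map_prod \<pi> id \<in> ell2"
      by (rule ell2_permute_first[OF x2 \<pi>(1)])
    fix l :: label and r :: 'r assume "l \<notin> S"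
    then have "\<pi> l \<notin> \<pi> ` S" using \<pi>(1) by (simp add: bij_is_inj inj_image_mem_iff)
    then show "(x2 \<circ> map_prod \<pi> id) (l, r) = 0" unfolding \<pi>S by (simp add: x2_def)
  qed
  then have "\<phi> x2 = 0" using inv[OF \<pi>(1) x2] by simp
  moreover have "x = (\<lambda>t. x1 t + x2 t)"
    by (rule ext) (simp add: x1_def x2_def case_prod_beta)
  ultimately show ?thesis using add[OF x1 x2] by simp
qed

section \<open>Functionals and operators on the tree\<close>

text \<open>
  Away from \<open>v\<close> the tree is the product of the set of branches with the set of positions in a
  branch. In these coordinates the permutations of the branches are automorphisms fixing \<open>v\<close>, so the
  functional \<open>z \<mapsto> \<phi> (ext z)\<close> of the proof is one to which
  \<open>permutation_invariant_functional_zero\<close> applies.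
\<close>

lemma invariant_functional_vanishes_off_root:
  fixes \<phi> :: "('v \<Rightarrow> complex) \<Rightarrow> complex"
  assumes tree: "aleph0_regular_tree E"
    and add: "\<And>x y. x \<in> ell2 \<Longrightarrow> y \<in> ell2 \<Longrightarrow> \<phi> (\<lambda>t. x t + y t) = \<phi> x + \<phi> y"
    and scale: "\<And>c x. x \<in> ell2 \<Longrightarrow> \<phi> (\<lambda>t. c * x t) = c * \<phi> x"
    and inv: "\<And>g x. g \<in> Aut E \<Longrightarrow> g v = v \<Longrightarrow> x \<in> ell2 \<Longrightarrow> \<phi> (lam g x) = \<phi> x"
    and x: "x \<in> ell2" "x v = 0"
  shows "\<phi> x = 0"
proof -
  let ?V = "vertex_at E v"
  have V: "inj ?V" "\<And>t. \<exists>l. t = ?V l" "\<And>l. inv ?V (?V l) = l" "?V [] = v"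
    using bij_vertex_at[OF tree, of v] by (auto simp: bij_def inv_f_f surj_def simp del: vertex_at_simps(2))
  have "infinite (UNIV :: label set)" by (simp add: finite_prod)
  then have "bij_betw (from_nat_into (UNIV :: label set)) UNIV UNIV"
    by (intro bij_betw_from_nat_into) auto
  then obtain d :: "nat \<Rightarrow> label" where d: "bij d" by blast
  define \<kappa> where "\<kappa> = (\<lambda>(i, r). ?V (r @ [inv d i]))"
  define ext where "ext z t = (let l = inv ?V t in if l = [] then 0 else z (d (last l), butlast l))"
    for z :: "label \<times> nat list \<Rightarrow> complex" and t
  have ext_V: "ext z (?V l) = (if l = [] then 0 else z (d (last l), butlast l))" for z l
    by (simp add: ext_def V(3) Let_def)
  have inj: "inj \<kappa>"
  proof (rule injI)
    fix p q assume "\<kappa> p = \<kappa> q"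
    then have "snd p @ [inv d (fst p)] = snd q @ [inv d (fst q)]"
      unfolding \<kappa>_def case_prod_beta by (rule injD[OF V(1)])
    then show "p = q"
      using bij_imp_bij_inv[OF d, THEN bij_is_inj] by (simp add: prod_eq_iff inj_eq)
  qed
  have \<kappa>: "?V (r @ [n]) = \<kappa> (d n, r)" for r n
    using d by (simp add: \<kappa>_def bij_is_inj)
  have ext_ell2: "ext z \<in> ell2" if "z \<in> ell2" for z
  proof (rule ell2_extend_by_zero[OF _ inj])
    have "ext z \<circ> \<kappa> = z"
      using d by (auto simp: fun_eq_iff \<kappa>_def ext_V bij_is_surj surj_f_inv_f)
    then show "ext z \<circ> \<kappa> \<in> ell2" using that by simp
    show "ext z t = 0" if "t \<notin> range \<kappa>" for t
    proof -
      obtain l where l: "t = ?V l" using V(2) by blast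
      show ?thesis
        using that ext_V[of z l] by (cases l rule: rev_exhaust) (auto simp: l \<kappa> simp del: vertex_at_simps)
    qed
  qed
  have "\<phi> (ext (x \<circ> \<kappa>)) = 0"
  proof (rule permutation_invariant_functional_zero[where \<phi> = "\<lambda>z. \<phi> (ext z)"])
    fix y z :: "label \<times> nat list \<Rightarrow> complex" assume "y \<in> ell2" "z \<in> ell2"
    moreover have "ext (\<lambda>t. y t + z t) = (\<lambda>t. ext y t + ext z t)"
      by (auto simp: ext_def Let_def)
    ultimately show "\<phi> (ext (\<lambda>t. y t + z t)) = \<phi> (ext y) + \<phi> (ext z)"
      by (simp add: add ext_ell2)
  next
    fix c and z :: "label \<times> nat list \<Rightarrow> complex" assume "z \<in> ell2"
    moreover have "ext (\<lambda>t. c * z t) = (\<lambda>t. c * ext z t)"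
      by (auto simp: ext_def Let_def)
    ultimately show "\<phi> (ext (\<lambda>t. c * z t)) = c * \<phi> (ext z)"
      by (simp add: scale ext_ell2)
  next
    fix \<pi> :: "label \<Rightarrow> label" and z :: "label \<times> nat list \<Rightarrow> complex" assume \<pi>: "bij \<pi>" and z: "z \<in> ell2"
    define \<rho> where "\<rho> = inv d \<circ> \<pi> \<circ> d"
    define g where "g = ?V \<circ> permute_branches \<rho> \<circ> inv ?V"
    have "bij \<rho>" unfolding \<rho>_def using d \<pi> by (intro bij_comp bij_imp_bij_inv)
    then have g: "g \<in> Aut E" unfolding g_def by (rule permute_branches_Aut[OF tree])
    have gV: "g (?V l) = ?V (permute_branches \<rho> l)" for l by (simp add: g_def V(3))
    have bij: "bij g" using g by (simp add: Aut_def)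
    have "g v = v" using gV[of "[]"] by simp
    then have "inv g v = v" using bij by (metis bij_inv_eq_iff)
    moreover have "lam (inv g) (ext z) = ext (z \<circ> map_prod \<pi> id)"
    proof
      fix t
      obtain l where l: "t = ?V l" using V(2) by blast
      have "ext z (g t) = ext (z \<circ> map_prod \<pi> id) t"
        using d by (cases l rule: rev_exhaust)
          (auto simp: l gV ext_V \<rho>_def bij_is_surj surj_f_inv_f simp del: vertex_at_simps)
      then show "lam (inv g) (ext z) t = ext (z \<circ> map_prod \<pi> id) t"
        using bij by (simp add: lam_def inv_inv_eq)
    qed
    ultimately show "\<phi> (ext (z \<circ> map_prod \<pi> id)) = \<phi> (ext z)"
      using inv[OF Aut_inv[OF g] _ ext_ell2[OF z]] by simp
  next
    show "x \<circ> \<kappa> \<in> ell2" by (rule ell2_reindex[OF x(1) inj])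
  qed
  moreover have "ext (x \<circ> \<kappa>) = x"
  proof
    fix t
    obtain l where l: "t = ?V l" using V(2) by blast
    show "ext (x \<circ> \<kappa>) t = x t"
      using x(2) V(4) ext_V[of "x \<circ> \<kappa>" l]
      by (cases l rule: rev_exhaust) (auto simp: l \<kappa> simp del: vertex_at_simps)
  qed
  ultimately show ?thesis by simp
qed

text \<open>
  Subtracting \<open>x v * dirac v\<close> from \<open>x\<close> reduces the claim to functions that vanish at \<open>v\<close>.
\<close>

lemma invariant_functional_is_evaluation:
  fixes \<phi> :: "('v \<Rightarrow> complex) \<Rightarrow> complex"
  assumes tree: "aleph0_regular_tree E"
    and add: "\<And>x y. x \<in> ell2 \<Longrightarrow> y \<in> ell2 \<Longrightarrow> \<phi> (\<lambda>t. x t + y t) = \<phi> x + \<phi> y"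
    and scale: "\<And>c x. x \<in> ell2 \<Longrightarrow> \<phi> (\<lambda>t. c * x t) = c * \<phi> x"
    and inv: "\<And>g x. g \<in> Aut E \<Longrightarrow> g v = v \<Longrightarrow> x \<in> ell2 \<Longrightarrow> \<phi> (lam g x) = \<phi> x"
    and x: "x \<in> ell2"
  shows "\<phi> x = \<phi> (dirac v) * x v"
proof -
  define x' where "x' = (\<lambda>t. if t = v then 0 else x t)"
  have x': "x' \<in> ell2" by (rule ell2_dominated[OF x]) (simp add: x'_def)
  have "\<phi> x' = 0"
    by (rule invariant_functional_vanishes_off_root[OF tree, where \<phi> = \<phi> and v = v])
      (use add scale inv x' in \<open>auto simp: x'_def\<close>)
  moreover have "x = (\<lambda>t. x v * dirac v t + x' t)"
    by (auto simp: x'_def dirac_def)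
  then have "\<phi> x = \<phi> (\<lambda>t. x v * dirac v t + x' t)" by simp
  ultimately show ?thesis
    by (simp add: add scale ell2_scale dirac_ell2 x' mult.commute)
qed

text \<open>
  Each coordinate of \<open>B\<close> is a functional invariant under a vertex stabilizer, which makes \<open>B\<close> a
  multiplication operator; transitivity makes its multiplier constant.
\<close>

theorem equivariant_operator_is_scalar:
  fixes B :: "('v \<Rightarrow> complex) \<Rightarrow> 'v \<Rightarrow> complex"
  assumes tree: "aleph0_regular_tree E"
    and lin: "linear_from ell2 B"
    and equi: "\<And>g x. g \<in> Aut E \<Longrightarrow> x \<in> ell2 \<Longrightarrow> B (lam g x) = lam g (B x)"
  shows "\<exists>\<theta>. \<forall>x\<in>ell2. B x = (\<lambda>s. \<theta> * x s)"
proof -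
  have add: "B (\<lambda>t. x t + y t) v = B x v + B y v" if "x \<in> ell2" "y \<in> ell2" for x y v
  proof -
    have "B (x + y) = B x + B y" using lin that by (simp add: linear_from_def)
    then show ?thesis by (simp add: plus_fun_def)
  qed
  have scale: "B (\<lambda>t. c * x t) v = c * B x v" if "x \<in> ell2" for c x v
    using lin that by (simp add: linear_from_def)
  have inv: "B (lam g x) v = B x v" if "g \<in> Aut E" "g v = v" "x \<in> ell2" for g x v
  proof -
    have "bij g" using that(1) by (simp add: Aut_def)
    then have "inv g v = v" using that(2) by (metis bij_inv_eq_iff)
    then show ?thesis using equi[OF that(1,3)] by (simp add: lam_def)
  qed
  have eval: "B x v = B (dirac v) v * x v" if "x \<in> ell2" for x v
    by (rule invariant_functional_is_evaluation[of E "\<lambda>x. B x v" v x, OF tree add scale inv that])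
  have "B (dirac v) v = B (dirac w) w" for v w
  proof -
    obtain g where g: "g \<in> Aut E" "g v = w" using Aut_transitive[OF tree] .
    then have "bij g" by (simp add: Aut_def)
    then have "inv g w = v" "inv g t = v \<longleftrightarrow> t = w" for t
      using g(2) by (metis bij_inv_eq_iff)+
    then have "lam g (dirac v) = dirac w" by (simp add: lam_def dirac_def)
    with equi[OF g(1) dirac_ell2] have "B (dirac w) w = B (dirac v) (inv g w)"
      by (metis lam_def)
    with \<open>inv g w = v\<close> show ?thesis by simp
  qed
  then have "B x = (\<lambda>s. B (dirac undefined) undefined * x s)" if "x \<in> ell2" for x
    using eval[OF that] by (metis ext)
  then show ?thesis by blast
qed

theorem theorem6:
  fixes E :: "'v \<Rightarrow> 'v \<Rightarrow> bool"
    and e :: 'v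
    and A :: "('v \<Rightarrow> complex) \<Rightarrow> ('v \<Rightarrow> complex)"
  assumes "aleph0_regular_tree E"
    and "linear_from ell2 A"
    and "\<And>g x. g \<in> Aut E \<Longrightarrow> x \<in> ell2 \<Longrightarrow> tree_derivation E e g x = A (lam g x) - lam g (A x)"
  shows "\<exists>\<theta> :: complex. \<forall>x\<in>ell2. A x = L_adj E e x + (\<lambda>s. \<theta> * x s)"
proof -
  define B where "B x = A x - L_adj E e x" for x
  have "linear_from ell2 B"
    using assms(2) by (auto simp: linear_from_def B_def L_adj_def fun_eq_iff algebra_simps)
  moreover have "B (lam g x) = lam g (B x)" if "g \<in> Aut E" "x \<in> ell2" for g x
  proof
    fix s
    have "tree_derivation E e g x s = (A (lam g x) - lam g (A x)) s" using assms(3)[OF that] by simp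
    then show "B (lam g x) s = lam g (B x) s"
      by (simp add: tree_derivation_def B_def lam_def algebra_simps)
  qed
  ultimately obtain \<theta> where "\<forall>x\<in>ell2. B x = (\<lambda>s. \<theta> * x s)"
    using equivariant_operator_is_scalar[OF assms(1)] by blast
  then have "A x = L_adj E e x + (\<lambda>s. \<theta> * x s)" if "x \<in> ell2" for x
    using that by (simp add: B_def fun_eq_iff) (metis add.commute diff_add_cancel)
  then show ?thesis by blast
qed

end
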